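(* Let $\sigma>0$, let $\varepsilon\sim\mathcal{N}(0,\sigma^2 I_d)$ be a Gaussian random variable, and let $f:\mathbb{R}^d\to\Delta^C$ be a confidence function. Then the soft smoothed confidence function $\bar g_f^\varepsilon:\mathbf{x}\mapsto\mathbb{E}_\varepsilon f(\mathbf{x}+\varepsilon)$ is $(2/\sigma^2)$-smooth.
   Context: $\Delta^C=\{\mathbf{p}\in\mathbb{R}^C_{\ge0}:\|\mathbf{p}\|_1=1\}$; $f$ is understood to be measurable so that the expectation is defined. $\beta$-smoothness: a differentiable $h:\mathbb{R}^d\to\mathbb{R}^C$ is $\beta$-smooth if $\|\nabla h(\mathbf{x}_1)_j-\nabla h(\mathbf{x}_2)_j\|_2\le\beta\|\mathbf{x}_1-\mathbf{x}_2\|_2$ for all $\mathbf{x}_1,\mathbf{x}_2\in\mathbb{R}^d$ and every output coordinate $j\in[C]$. *)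

theory Defs
  imports "HOL-Probability.Probability"
begin

definition prob_simplex :: "(real ^ 'c) set" where
  "prob_simplex = {p. (\<forall>i. 0 \<le> p $ i) \<and> (\<Sum>i\<in>UNIV. \<bar>p $ i\<bar>) = 1}"

text \<open>The Lebesgue density of \<open>N(0, \<sigma>\<^sup>2 I\<^sub>d)\<close> on \<open>real ^ 'd\<close>, where \<open>d = CARD('d)\<close>.\<close>

definition gaussian_density :: "real \<Rightarrow> real ^ 'd \<Rightarrow> real" where
  "gaussian_density \<sigma> x =
     1 / sqrt (2 * pi * \<sigma>\<^sup>2) ^ CARD('d) * exp (- (norm x)\<^sup>2 / (2 * \<sigma>\<^sup>2))"

lemma gaussian_density_eq_prod_normal_density:
  "gaussian_density \<sigma> x = (\<Prod>i\<in>UNIV. normal_density 0 \<sigma> (x $ i))"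
proof -
  have "(norm x)\<^sup>2 = (\<Sum>i\<in>UNIV. (x $ i)\<^sup>2)"
    by (simp add: norm_vec_def L2_set_def sum_nonneg)
  then have "exp (- (norm x)\<^sup>2 / (2 * \<sigma>\<^sup>2)) = (\<Prod>i\<in>UNIV. exp (- (x $ i)\<^sup>2 / (2 * \<sigma>\<^sup>2)))"
    by (simp add: sum_divide_distrib sum_negf flip: exp_sum)
  then show ?thesis
    by (simp only: gaussian_density_def normal_density_def prod.distrib prod_constant
        power_one_over diff_zero)
qed

definition gaussian_rv :: "'a measure \<Rightarrow> real \<Rightarrow> ('a \<Rightarrow> real ^ 'd) \<Rightarrow> bool" where
  "gaussian_rv M \<sigma> \<epsilon> \<longleftrightarrow>
     prob_space M \<and> distributed M lborel \<epsilon> (\<lambda>x. ennreal (gaussian_density \<sigma> x))"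

definition gradient :: "('v::real_inner \<Rightarrow> real) \<Rightarrow> 'v \<Rightarrow> 'v" where
  "gradient h x = (THE D. GDERIV h x :> D)"

lemma gradient_eqI:
  assumes "GDERIV h x :> D"
  shows "gradient h x = D"
  unfolding gradient_def
proof (rule the_equality)
  fix E assume "GDERIV h x :> E"
  with assms have "(\<lambda>y. y \<bullet> E) = (\<lambda>y. y \<bullet> D)"
    unfolding gderiv_def by (intro has_derivative_unique)
  then have "(E - D) \<bullet> E = (E - D) \<bullet> D"
    by (rule fun_cong)
  then have "(E - D) \<bullet> (E - D) = 0"
    by (simp only: inner_diff_right diff_self)
  then show "E = D"
    by (simp only: inner_eq_zero_iff right_minus_eq)
qed (fact assms)

definition smooth_with :: "real \<Rightarrow> (real ^ 'd \<Rightarrow> real ^ 'c) \<Rightarrow> bool" where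
  "smooth_with \<beta> h \<longleftrightarrow>
     (\<forall>x. h differentiable (at x)) \<and>
     (\<forall>j x\<^sub>1 x\<^sub>2. norm (gradient (\<lambda>x. h x $ j) x\<^sub>1 - gradient (\<lambda>x. h x $ j) x\<^sub>2)
        \<le> \<beta> * norm (x\<^sub>1 - x\<^sub>2))"

definition soft_smoothed ::
  "'a measure \<Rightarrow> ('a \<Rightarrow> real ^ 'd) \<Rightarrow> (real ^ 'd \<Rightarrow> real ^ 'c) \<Rightarrow> real ^ 'd \<Rightarrow> real ^ 'c" where
  "soft_smoothed M \<epsilon> f x = (\<integral>\<omega>. f (x + \<epsilon> \<omega>) \<partial>M)"

end

theory Submission imports Defs "HOL-Real_Asymp.Real_Asymp" begin

text \<open>
  Let \<open>\<phi>\<close> be the Gaussian density, \<open>\<psi>\<^sub>v(z) = (v \<bullet> z) \<phi>(z)\<close>, and let \<open>F\<close> be a coordinate of \<open>f\<close>, so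
  that \<open>\<bar>F\<bar> \<le> 1\<close> and the coordinate of the smoothed function is \<open>\<integral> F(y) \<phi>(y - x) dy\<close>. The gradient
  of this in direction \<open>v\<close> is \<open>\<sigma>\<^sup>-\<^sup>2 \<integral> F(y) \<psi>\<^sub>v(y - x) dy\<close>, so everything reduces to the estimate
  \<open>\<integral> \<bar>\<psi>\<^sub>v(z + h) - \<psi>\<^sub>v(z)\<bar> dz \<le> 2 \<parallel>v\<parallel> \<parallel>h\<parallel>\<close>. Integrating along the segment from \<open>z\<close> to \<open>z + h\<close>
  and exchanging integrals, this follows from
  \<open>\<integral> \<bar>v \<bullet> h - (v \<bullet> z)(h \<bullet> z) / \<sigma>\<^sup>2\<bar> \<phi>(z) dz \<le> 2 \<parallel>v\<parallel> \<parallel>h\<parallel>\<close>, which is a second moment bound. The same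
  estimate, integrated once more, bounds the \<open>L\<^sup>1\<close> norm of the first-order Taylor remainder of \<open>\<phi>\<close> by
  \<open>2 \<parallel>h\<parallel>\<^sup>2 / \<sigma>\<^sup>2\<close>, which gives differentiability without differentiating under the integral sign.
\<close>

section \<open>The Gaussian density and its total mass\<close>

lemma gaussian_density_nonneg: "0 \<le> gaussian_density \<sigma> x"
  by (simp add: gaussian_density_def)

lemma continuous_on_gaussian_density [continuous_intros]:
  assumes "continuous_on S f"
  shows "continuous_on S (\<lambda>x. gaussian_density \<sigma> (f x))"
  using assms unfolding gaussian_density_def divide_inverse by (intro continuous_intros) auto

lemma borel_measurable_gaussian_density [measurable]:
  "gaussian_density \<sigma> \<in> borel_measurable borel"
  by (intro borel_measurable_continuous_onI continuous_intros)

lemma prod_Basis_vec_real: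
  fixes f :: "real ^ 'n \<Rightarrow> 'b::comm_monoid_mult"
  shows "(\<Prod>b\<in>Basis. f b) = (\<Prod>i\<in>UNIV. f (axis i 1))"
proof -
  have "(Basis :: (real ^ 'n) set) = range (\<lambda>i. axis i 1)"
    by (auto simp: Basis_vec_def)
  moreover have "inj (\<lambda>i::'n. axis i (1::real))"
    by (auto simp: inj_on_def axis_eq_axis)
  ultimately show ?thesis
    using prod.reindex[of "\<lambda>i::'n. axis i 1" UNIV f] by simp
qed

text \<open>The density factors into one-dimensional normal densities over the standard basis, so
  Tonelli reduces the claim to total mass 1 on the line.\<close>

lemma nn_integral_gaussian_density:
  assumes "\<sigma> > 0"
  shows "(\<integral>\<^sup>+x. ennreal (gaussian_density \<sigma> x) \<partial>(lborel :: (real ^ 'n) measure)) = 1"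
proof -
  have "(\<integral>\<^sup>+x. ennreal (normal_density 0 \<sigma> x) \<partial>lborel) = 1"
    using assms by (simp add: nn_integral_eq_integral)
  moreover have "ennreal (gaussian_density \<sigma> x) = (\<Prod>b\<in>Basis. ennreal (normal_density 0 \<sigma> (x \<bullet> b)))" for x :: "real ^ 'n"
    by (simp add: gaussian_density_eq_prod_normal_density prod_Basis_vec_real inner_axis prod_ennreal)
  ultimately show ?thesis
    using nn_integral_lborel_prod[where f = "\<lambda>(b :: real ^ 'n) x. ennreal (normal_density 0 \<sigma> x)"] by simp
qed

lemma nn_integral_lborel_translate:
  fixes f :: "'a::euclidean_space \<Rightarrow> ennreal"
  assumes [measurable]: "f \<in> borel_measurable borel"
  shows "(\<integral>\<^sup>+x. f (a + x) \<partial>lborel) = (\<integral>\<^sup>+x. f x \<partial>lborel)"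
  by (subst (2) lborel_affine[of 1 a]) (simp_all add: nn_integral_density nn_integral_distr)

section \<open>Exponential and second moments\<close>

text \<open>Completing the square: an exponential tilt of a Gaussian is, up to a constant, a
  Gaussian with shifted mean.\<close>

lemma gaussian_density_exp_tilt:
  assumes "\<sigma> > 0"
  shows "gaussian_density \<sigma> (z - \<sigma>\<^sup>2 *\<^sub>R v) * exp (\<sigma>\<^sup>2 * (norm v)\<^sup>2 / 2) = gaussian_density \<sigma> z * exp (v \<bullet> z)"
proof -
  have "(norm (z - \<sigma>\<^sup>2 *\<^sub>R v))\<^sup>2 = (norm z)\<^sup>2 - 2 * \<sigma>\<^sup>2 * (v \<bullet> z) + \<sigma>\<^sup>2 * \<sigma>\<^sup>2 * (norm v)\<^sup>2"
    unfolding power2_norm_eq_inner by (simp add: inner_diff_left inner_diff_right inner_commute algebra_simps)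
  then have "- (norm (z - \<sigma>\<^sup>2 *\<^sub>R v))\<^sup>2 / (2 * \<sigma>\<^sup>2) + \<sigma>\<^sup>2 * (norm v)\<^sup>2 / 2 = - (norm z)\<^sup>2 / (2 * \<sigma>\<^sup>2) + v \<bullet> z"
    using assms by (simp add: add_divide_distrib diff_divide_distrib power2_eq_square)
  then show ?thesis
    unfolding gaussian_density_def by (simp add: mult.assoc flip: exp_add)
qed

text \<open>The moment generating function: after the tilt identity, translation invariance leaves
  the total mass times a constant.\<close>

lemma nn_integral_gaussian_exp:
  fixes v :: "real ^ 'd"
  assumes "\<sigma> > 0"
  shows "(\<integral>\<^sup>+z. ennreal (gaussian_density \<sigma> z * exp (v \<bullet> z)) \<partial>lborel) = exp (\<sigma>\<^sup>2 * (norm v)\<^sup>2 / 2)"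
proof -
  have "(\<integral>\<^sup>+z. ennreal (gaussian_density \<sigma> z * exp (v \<bullet> z)) \<partial>lborel) =
    (\<integral>\<^sup>+z. ennreal (gaussian_density \<sigma> (- (\<sigma>\<^sup>2 *\<^sub>R v) + z)) * ennreal (exp (\<sigma>\<^sup>2 * (norm v)\<^sup>2 / 2)) \<partial>lborel)"
    by (simp add: gaussian_density_exp_tilt[OF assms, symmetric] ennreal_mult' gaussian_density_nonneg)
  also have "\<dots> = (\<integral>\<^sup>+z. ennreal (gaussian_density \<sigma> z) \<partial>(lborel :: (real ^ 'd) measure)) * ennreal (exp (\<sigma>\<^sup>2 * (norm v)\<^sup>2 / 2))"
    using nn_integral_lborel_translate[of "\<lambda>z. ennreal (gaussian_density \<sigma> z)" "- (\<sigma>\<^sup>2 *\<^sub>R v)"]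
    by (subst nn_integral_multc) simp_all
  finally show ?thesis
    by (simp add: nn_integral_gaussian_density[OF assms])
qed

lemma abs_le_abs_sinh: "\<bar>x\<bar> \<le> \<bar>sinh (x::real)\<bar>"
proof -
  have "y \<le> sinh y" if "0 \<le> y" for y :: real
  proof -
    have "sinh 0 - 0 \<le> sinh y - y"
      by (rule DERIV_nonneg_imp_nondecreasing[OF that])
        (auto intro!: derivative_eq_intros exI cosh_real_ge_1 simp: cosh_real_ge_1)
    then show ?thesis by simp
  qed
  from this[of x] this[of "- x"] show ?thesis by (cases "0 \<le> x") auto
qed

text \<open>This is \<open>\<bar>y\<bar> \<le> \<bar>sinh y\<bar>\<close> squared at
  \<open>y = x / 2\<close>, since the right side equals
  \<open>4 * (sinh (x / 2))\<^sup>2 + 2\<close>.\<close>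

lemma square_le_exp_add_exp_minus: "x\<^sup>2 + 2 \<le> exp x + exp (- x :: real)"
proof -
  have "(x / 2)\<^sup>2 \<le> (sinh (x / 2))\<^sup>2"
    using abs_le_abs_sinh by (simp add: abs_le_square_iff)
  moreover have "4 * (sinh (x / 2))\<^sup>2 + 2 = exp x + exp (- x)"
    by (simp add: sinh_field_def power2_eq_square field_simps flip: exp_add)
  ultimately show ?thesis by (simp add: power_divide)
qed

text \<open>Bounding \<open>x\<^sup>2\<close> by \<open>2 (cosh x - 1)\<close> reduces second moments to the moment generating function.\<close>

lemma nn_integral_gaussian_inner_square_le_exp:
  assumes "\<sigma> > 0"
  shows "(\<integral>\<^sup>+z. ennreal (gaussian_density \<sigma> z * (v \<bullet> z)\<^sup>2) \<partial>lborel)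
    \<le> ennreal (2 * (exp (\<sigma>\<^sup>2 * (norm v)\<^sup>2 / 2) - 1))" (is "?I \<le> _")
proof -
  let ?e = "exp (\<sigma>\<^sup>2 * (norm v)\<^sup>2 / 2)"
  \<comment> \<open>The summand 2 is twice the total mass. Carrying it on both sides and cancelling
    at the end avoids subtraction in \<open>ennreal\<close>.\<close>
  have "?I + 2 = (\<integral>\<^sup>+z. ennreal (gaussian_density \<sigma> z * (v \<bullet> z)\<^sup>2) + ennreal (gaussian_density \<sigma> z) * 2 \<partial>lborel)"
    by (simp add: nn_integral_add nn_integral_multc nn_integral_gaussian_density[OF assms])
  also have "\<dots> = (\<integral>\<^sup>+z. ennreal (gaussian_density \<sigma> z * ((v \<bullet> z)\<^sup>2 + 2)) \<partial>lborel)"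
    by (simp add: distrib_left gaussian_density_nonneg ennreal_plus ennreal_mult')
  also have "\<dots> \<le> (\<integral>\<^sup>+z. ennreal (gaussian_density \<sigma> z * (exp (v \<bullet> z) + exp (- v \<bullet> z))) \<partial>lborel)"
    using square_le_exp_add_exp_minus
    by (intro nn_integral_mono ennreal_leI mult_left_mono) (auto simp: gaussian_density_nonneg)
  also have "\<dots> = (\<integral>\<^sup>+z. ennreal (gaussian_density \<sigma> z * exp (v \<bullet> z)) + ennreal (gaussian_density \<sigma> z * exp (- v \<bullet> z)) \<partial>lborel)"
    by (simp add: distrib_left gaussian_density_nonneg ennreal_plus)
  also have "\<dots> = ennreal ?e + ennreal ?e"
    using nn_integral_gaussian_exp[OF assms, of v] nn_integral_gaussian_exp[OF assms, of "- v"]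
    by (subst nn_integral_add) auto
  also have "\<dots> = ennreal (2 * (?e - 1)) + 2"
    by (simp add: ennreal_plus[symmetric] del: ennreal_plus flip: ennreal_numeral)
  finally show ?thesis
    by (simp add: ennreal_add_left_cancel_le add.commute[of _ 2])
qed

text \<open>The exponential bound becomes sharp for small vectors: apply it to
  \<open>s *\<^sub>R v\<close>, divide by \<open>s\<^sup>2\<close> and let \<open>s\<close> tend to
  0 from the right. The bound then tends to the true variance.\<close>

lemma nn_integral_gaussian_inner_square_le:
  assumes "\<sigma> > 0"
  shows "(\<integral>\<^sup>+z. ennreal (gaussian_density \<sigma> z * (v \<bullet> z)\<^sup>2) \<partial>lborel) \<le> ennreal (\<sigma>\<^sup>2 * (norm v)\<^sup>2)"
    (is "?I v \<le> _")
proof -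
  let ?A = "\<sigma>\<^sup>2 * (norm v)\<^sup>2"
  let ?r = "\<lambda>s. 2 * (exp (s\<^sup>2 * ?A / 2) - 1) / s\<^sup>2"
  have le: "?I v \<le> ennreal (?r s)" if "s > 0" for s
  proof -
    have "ennreal (s\<^sup>2) * ?I v = ?I (s *\<^sub>R v)"
      by (subst nn_integral_cmult[symmetric])
        (auto intro!: nn_integral_cong simp: power_mult_distrib mult_ac simp flip: ennreal_mult')
    also have "\<dots> \<le> ennreal (2 * (exp (s\<^sup>2 * ?A / 2) - 1))"
      using nn_integral_gaussian_inner_square_le_exp[OF assms, of "s *\<^sub>R v"]
      by (simp add: power_mult_distrib mult_ac)
    finally have "ennreal (1 / s\<^sup>2) * (ennreal (s\<^sup>2) * ?I v) \<le> ennreal (1 / s\<^sup>2) * ennreal (2 * (exp (s\<^sup>2 * ?A / 2) - 1))"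
      by (rule mult_left_mono) simp
    then show ?thesis
      using that by (simp add: mult.assoc[symmetric] flip: ennreal_mult')
  qed
  have "((\<lambda>s. ennreal (?r s)) \<longlongrightarrow> ennreal ?A) (at_right 0)"
    by (intro tendsto_ennrealI) real_asymp
  then show ?thesis
  proof (rule tendsto_lowerbound)
    show "\<forall>\<^sub>F s in at_right 0. ?I v \<le> ennreal (?r s)"
      using eventually_at_right_less[of 0] by (rule eventually_mono) (rule le)
  qed simp
qed

section \<open>Bounds in L^1 for increments of the density and its slope\<close>

text \<open>For fixed \<open>z\<close> the increment is the integral of \<open>q t z\<close> over
  \<open>t\<close> in [0,1]. Tonelli then turns a bound that is uniform in \<open>t\<close> into a
  bound for the increment.\<close>

lemma nn_integral_increment_le:
  fixes p q :: "real \<Rightarrow> 'a::euclidean_space \<Rightarrow> real"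
  assumes deriv: "\<And>t z. 0 \<le> t \<Longrightarrow> t \<le> 1 \<Longrightarrow> ((\<lambda>s. p s z) has_real_derivative q t z) (at t)"
    and cont: "continuous_on UNIV (\<lambda>(t, z). q t z)"
    and bound: "\<And>t. 0 \<le> t \<Longrightarrow> t \<le> 1 \<Longrightarrow> (\<integral>\<^sup>+z. ennreal \<bar>q t z\<bar> \<partial>lborel) \<le> ennreal K"
  shows "(\<integral>\<^sup>+z. ennreal \<bar>p 1 z - p 0 z\<bar> \<partial>lborel) \<le> ennreal K"
proof -
  \<comment> \<open>Continuity on the product space supplies the joint measurability that Tonelli
    requires.\<close>
  have q [measurable]: "(\<lambda>x. q (fst x) (snd x)) \<in> borel_measurable (borel \<Otimes>\<^sub>M borel)"
    using borel_measurable_continuous_onI[OF cont] by (simp add: borel_prod case_prod_unfold)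
  have "ennreal \<bar>p 1 z - p 0 z\<bar> \<le> (\<integral>\<^sup>+t. ennreal \<bar>q t z\<bar> * indicator {0..1} t \<partial>lborel)" for z
  proof -
    have "continuous_on UNIV (\<lambda>t. q t z)"
      using continuous_on_compose2[OF cont, of UNIV "\<lambda>t. (t, z)"] by (simp add: continuous_on_Pair)
    then have "isCont (\<lambda>t. q t z) t" for t
      by (simp add: continuous_on_eq_continuous_at)
    then have *: "has_bochner_integral lborel (\<lambda>t. q t z * indicator {0..1} t) (p 1 z - p 0 z)"
      by (intro has_bochner_integral_FTC_Icc_real deriv) auto
    show ?thesis
      using has_bochner_integral_norm_bound[OF *]
      by (simp add: abs_mult ennreal_mult' ennreal_indicator flip: ennreal_indicator)
  qed
  then have "(\<integral>\<^sup>+z. ennreal \<bar>p 1 z - p 0 z\<bar> \<partial>lborel)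
      \<le> (\<integral>\<^sup>+z. (\<integral>\<^sup>+t. ennreal \<bar>q t z\<bar> * indicator {0..1} t \<partial>lborel) \<partial>lborel)"
    by (intro nn_integral_mono)
  also have "\<dots> = (\<integral>\<^sup>+t. (\<integral>\<^sup>+z. ennreal \<bar>q t z\<bar> * indicator {0..1} t \<partial>lborel) \<partial>lborel)"
    by (rule lborel_pair.Fubini') (simp add: case_prod_unfold)
  also have "\<dots> \<le> (\<integral>\<^sup>+t. ennreal K * indicator {0..1} t \<partial>(lborel :: real measure))"
    by (intro nn_integral_mono) (auto simp: bound split: split_indicator)
  also have "\<dots> = ennreal K"
    by (simp add: nn_integral_cmult)
  finally show ?thesis .
qed

lemma has_real_derivative_gaussian_density_line:
  assumes "\<sigma> > 0"
  shows "((\<lambda>t. gaussian_density \<sigma> (z + t *\<^sub>R h)) has_real_derivative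
    - (h \<bullet> (z + t *\<^sub>R h)) * gaussian_density \<sigma> (z + t *\<^sub>R h) / \<sigma>\<^sup>2) (at t)"
proof -
  \<comment> \<open>This makes the exponent a polynomial in \<open>t\<close>, so no derivative of
    the norm is involved.\<close>
  have "(norm (z + t *\<^sub>R h))\<^sup>2 = z \<bullet> z + 2 * t * (h \<bullet> z) + t\<^sup>2 * (h \<bullet> h)" for t
    unfolding power2_norm_eq_inner
    by (simp add: inner_add_left inner_add_right inner_commute power2_eq_square algebra_simps)
  then show ?thesis
    unfolding gaussian_density_def using assms
    by (auto intro!: derivative_eq_intros simp: inner_add_right field_simps power2_eq_square)
qed

lemma integrable_gaussian_inner_square:
  fixes v :: "real ^ 'd"
  assumes "\<sigma> > 0"
  shows "integrable lborel (\<lambda>z. gaussian_density \<sigma> z * (v \<bullet> z)\<^sup>2)"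
    and "(\<integral>z. gaussian_density \<sigma> z * (v \<bullet> z)\<^sup>2 \<partial>lborel) \<le> \<sigma>\<^sup>2 * (norm v)\<^sup>2"
proof -
  note I = nn_integral_gaussian_inner_square_le[OF assms, of v]
  show "integrable lborel (\<lambda>z. gaussian_density \<sigma> z * (v \<bullet> z)\<^sup>2)"
    using le_less_trans[OF I] by (intro integrableI_nonneg) (auto simp: gaussian_density_nonneg)
  then show "(\<integral>z. gaussian_density \<sigma> z * (v \<bullet> z)\<^sup>2 \<partial>lborel) \<le> \<sigma>\<^sup>2 * (norm v)\<^sup>2"
    using I by (subst (asm) nn_integral_eq_integral) (auto simp: gaussian_density_nonneg)
qed

lemma integrable_gaussian_density:
  assumes "\<sigma> > 0"
  shows "integrable lborel (gaussian_density \<sigma> :: real ^ 'd \<Rightarrow> real)"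
  using nn_integral_gaussian_density[OF assms, where 'n = 'd]
  by (intro integrableI_nonneg) (auto simp: gaussian_density_nonneg)

lemma integral_gaussian_density:
  assumes "\<sigma> > 0"
  shows "(\<integral>z. gaussian_density \<sigma> z \<partial>(lborel :: (real ^ 'd) measure)) = 1"
  using nn_integral_gaussian_density[OF assms, where 'n = 'd]
  by (subst (asm) nn_integral_eq_integral)
    (auto simp: gaussian_density_nonneg integrable_gaussian_density[OF assms])

text \<open>The integrand is, up to a constant factor, a second directional derivative of the
  density. The constant 2 is the sum of 1 from Cauchy-Schwarz on \<open>v \<bullet> h\<close> and 1
  from the second moments.\<close>

lemma nn_integral_gaussian_hessian_le:
  fixes v h :: "real ^ 'd"
  assumes "\<sigma> > 0"
  shows "(\<integral>\<^sup>+z. ennreal \<bar>(v \<bullet> h - (v \<bullet> z) * (h \<bullet> z) / \<sigma>\<^sup>2) * gaussian_density \<sigma> z\<bar> \<partial>lborel)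
    \<le> ennreal (2 * norm v * norm h)"
proof (cases "v = 0 \<or> h = 0")
  case False
  \<comment> \<open>The weights are chosen so that, after the second moment bound, each quadratic
    term contributes at most \<open>norm v * norm h / 2\<close>.\<close>
  let ?c = "norm h / (2 * norm v * \<sigma>\<^sup>2)" and ?d = "norm v / (2 * norm h * \<sigma>\<^sup>2)"
  let ?G = "\<lambda>z. \<bar>v \<bullet> h\<bar> * gaussian_density \<sigma> z + ?c * (gaussian_density \<sigma> z * (v \<bullet> z)\<^sup>2)
      + ?d * (gaussian_density \<sigma> z * (h \<bullet> z)\<^sup>2)"
  have int: "integrable lborel ?G"
    by (intro Bochner_Integration.integrable_add integrable_mult_right integrable_gaussian_density
        integrable_gaussian_inner_square assms)
  have "\<bar>(v \<bullet> h - (v \<bullet> z) * (h \<bullet> z) / \<sigma>\<^sup>2) * gaussian_density \<sigma> z\<bar> \<le> ?G z" for z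
  proof -
    \<comment> \<open>AM-GM with the weights \<open>norm h / norm v\<close> and \<open>norm v / norm h\<close>\<close>
    have "0 \<le> (norm h * \<bar>v \<bullet> z\<bar> - norm v * \<bar>h \<bullet> z\<bar>)\<^sup>2 / (2 * norm v * norm h * \<sigma>\<^sup>2)"
      by simp
    also have "\<dots> = ?c * (v \<bullet> z)\<^sup>2 + ?d * (h \<bullet> z)\<^sup>2 - \<bar>v \<bullet> z\<bar> * \<bar>h \<bullet> z\<bar> / \<sigma>\<^sup>2"
      using False assms by (simp add: power2_diff power_mult_distrib field_simps) (simp add: power2_eq_square)
    finally have "\<bar>v \<bullet> h - (v \<bullet> z) * (h \<bullet> z) / \<sigma>\<^sup>2\<bar> \<le> \<bar>v \<bullet> h\<bar> + ?c * (v \<bullet> z)\<^sup>2 + ?d * (h \<bullet> z)\<^sup>2"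
      using abs_triangle_ineq4[of "v \<bullet> h" "(v \<bullet> z) * (h \<bullet> z) / \<sigma>\<^sup>2"] by (simp add: abs_mult)
    then have "\<bar>v \<bullet> h - (v \<bullet> z) * (h \<bullet> z) / \<sigma>\<^sup>2\<bar> * gaussian_density \<sigma> z
        \<le> (\<bar>v \<bullet> h\<bar> + ?c * (v \<bullet> z)\<^sup>2 + ?d * (h \<bullet> z)\<^sup>2) * gaussian_density \<sigma> z"
      by (rule mult_right_mono) (rule gaussian_density_nonneg)
    also have "\<dots> = ?G z"
      by (simp add: algebra_simps)
    finally show ?thesis
      by (simp only: abs_mult abs_of_nonneg[OF gaussian_density_nonneg])
  qed
  then have "(\<integral>\<^sup>+z. ennreal \<bar>(v \<bullet> h - (v \<bullet> z) * (h \<bullet> z) / \<sigma>\<^sup>2) * gaussian_density \<sigma> z\<bar> \<partial>lborel)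
      \<le> (\<integral>\<^sup>+z. ennreal (?G z) \<partial>lborel)"
    by (intro nn_integral_mono ennreal_leI)
  also have "\<dots> = ennreal (\<integral>z. ?G z \<partial>lborel)"
    by (intro nn_integral_eq_integral int) (auto simp: gaussian_density_nonneg)
  also have "\<dots> \<le> ennreal (2 * norm v * norm h)"
  proof (rule ennreal_leI)
    have "(\<integral>z. ?G z \<partial>lborel) = \<bar>v \<bullet> h\<bar> + ?c * (\<integral>z. gaussian_density \<sigma> z * (v \<bullet> z)\<^sup>2 \<partial>lborel)
        + ?d * (\<integral>z. gaussian_density \<sigma> z * (h \<bullet> z)\<^sup>2 \<partial>lborel)"
      by (simp add: integrable_gaussian_inner_square integrable_gaussian_density integral_gaussian_density assms
        del: times_divide_eq_left)
    also have "\<dots> \<le> norm v * norm h + ?c * (\<sigma>\<^sup>2 * (norm v)\<^sup>2) + ?d * (\<sigma>\<^sup>2 * (norm h)\<^sup>2)"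
      by (intro add_mono mult_left_mono Cauchy_Schwarz_ineq2 integrable_gaussian_inner_square assms) simp_all
    also have "\<dots> = 2 * norm v * norm h"
      using False assms by (simp add: field_simps power2_eq_square)
    finally show "(\<integral>z. ?G z \<partial>lborel) \<le> 2 * norm v * norm h" .
  qed
  finally show ?thesis .
qed auto

text \<open>Up to the factor \<open>- 1 / \<sigma>\<^sup>2\<close>, the derivative of the Gaussian density in direction \<open>v\<close>.\<close>

definition gaussian_slope :: "real \<Rightarrow> real ^ 'd \<Rightarrow> real ^ 'd \<Rightarrow> real" where
  "gaussian_slope \<sigma> v z = (v \<bullet> z) * gaussian_density \<sigma> z"

lemma continuous_on_gaussian_slope [continuous_intros]:
  "continuous_on S f \<Longrightarrow> continuous_on S (\<lambda>x. gaussian_slope \<sigma> v (f x))"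
  unfolding gaussian_slope_def by (intro continuous_intros)

lemma borel_measurable_gaussian_slope [measurable]:
  "gaussian_slope \<sigma> v \<in> borel_measurable borel"
  unfolding gaussian_slope_def by measurable

lemma gaussian_slope_scaleR: "gaussian_slope \<sigma> (c *\<^sub>R v) z = c * gaussian_slope \<sigma> v z"
  by (simp add: gaussian_slope_def)

lemma gaussian_slope_minus: "gaussian_slope \<sigma> (- v) z = - gaussian_slope \<sigma> v z"
  by (simp add: gaussian_slope_def)

text \<open>The derivative along the segment from \<open>z\<close> to \<open>z + h\<close> is the
  Hessian-type integrand at a translated point. Translation invariance makes its L^1 norm
  independent of \<open>t\<close>.\<close>

lemma nn_integral_gaussian_slope_increment_le:
  assumes "\<sigma> > 0"
  shows "(\<integral>\<^sup>+z. ennreal \<bar>gaussian_slope \<sigma> v (z + h) - gaussian_slope \<sigma> v z\<bar> \<partial>lborel)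
    \<le> ennreal (2 * norm v * norm h)"
proof -
  let ?q = "\<lambda>w. (v \<bullet> h - (v \<bullet> w) * (h \<bullet> w) / \<sigma>\<^sup>2) * gaussian_density \<sigma> w"
  have "(\<integral>\<^sup>+z. ennreal \<bar>gaussian_slope \<sigma> v (z + 1 *\<^sub>R h) - gaussian_slope \<sigma> v (z + 0 *\<^sub>R h)\<bar> \<partial>lborel)
    \<le> ennreal (2 * norm v * norm h)"
  proof (rule nn_integral_increment_le)
    show "((\<lambda>t. gaussian_slope \<sigma> v (z + t *\<^sub>R h)) has_real_derivative ?q (z + t *\<^sub>R h)) (at t)" for t z
      unfolding gaussian_slope_def inner_add_right inner_scaleR_right using assms
      by (auto intro!: derivative_eq_intros has_real_derivative_gaussian_density_line
          simp: inner_add_right field_simps)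
    show "continuous_on UNIV (\<lambda>(t, z). ?q (z + t *\<^sub>R h))"
      using assms unfolding case_prod_unfold by (intro continuous_intros) auto
    show "(\<integral>\<^sup>+z. ennreal \<bar>?q (z + t *\<^sub>R h)\<bar> \<partial>lborel) \<le> ennreal (2 * norm v * norm h)" for t
      using nn_integral_lborel_translate[of "\<lambda>w. ennreal \<bar>?q w\<bar>" "t *\<^sub>R h"]
        nn_integral_gaussian_hessian_le[OF assms, of v h]
      by (simp add: add.commute)
  qed
  then show ?thesis by simp
qed

lemma nn_integral_gaussian_density_remainder_le:
  assumes "\<sigma> > 0"
  shows "(\<integral>\<^sup>+z. ennreal \<bar>gaussian_density \<sigma> (z + h) - gaussian_density \<sigma> z + gaussian_slope \<sigma> h z / \<sigma>\<^sup>2\<bar> \<partial>lborel)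
    \<le> ennreal (2 / \<sigma>\<^sup>2 * (norm h)\<^sup>2)"
proof -
  \<comment> \<open>The term linear in \<open>t\<close> makes \<open>?p 1 z - ?p 0 z\<close> the
    Taylor remainder, while the derivative \<open>?q\<close> is a scaled increment of the
    slope.\<close>
  let ?p = "\<lambda>t z. gaussian_density \<sigma> (z + t *\<^sub>R h) + t * (gaussian_slope \<sigma> h z / \<sigma>\<^sup>2)"
  let ?q = "\<lambda>t z. (- 1 / \<sigma>\<^sup>2) * (gaussian_slope \<sigma> h (z + t *\<^sub>R h) - gaussian_slope \<sigma> h z)"
  have "(\<integral>\<^sup>+z. ennreal \<bar>?p 1 z - ?p 0 z\<bar> \<partial>lborel) \<le> ennreal (2 / \<sigma>\<^sup>2 * (norm h)\<^sup>2)"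
  proof (rule nn_integral_increment_le)
    show "((\<lambda>t. ?p t z) has_real_derivative ?q t z) (at t)" for t z
      unfolding gaussian_slope_def using assms
      by (auto intro!: derivative_eq_intros has_real_derivative_gaussian_density_line simp: field_simps)
    show "continuous_on UNIV (\<lambda>(t, z). ?q t z)"
      using assms unfolding case_prod_unfold by (intro continuous_intros) auto
    show "(\<integral>\<^sup>+z. ennreal \<bar>?q t z\<bar> \<partial>lborel) \<le> ennreal (2 / \<sigma>\<^sup>2 * (norm h)\<^sup>2)" if "0 \<le> t" "t \<le> 1" for t
    proof -
      have "(\<integral>\<^sup>+z. ennreal \<bar>?q t z\<bar> \<partial>lborel) = ennreal (1 / \<sigma>\<^sup>2) *
          (\<integral>\<^sup>+z. ennreal \<bar>gaussian_slope \<sigma> h (z + t *\<^sub>R h) - gaussian_slope \<sigma> h z\<bar> \<partial>lborel)"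
        by (subst nn_integral_cmult[symmetric]) (simp_all add: abs_mult flip: ennreal_mult')
      also have "\<dots> \<le> ennreal (1 / \<sigma>\<^sup>2) * ennreal (2 * norm h * norm (t *\<^sub>R h))"
        by (intro mult_left_mono nn_integral_gaussian_slope_increment_le assms) simp
      \<comment> \<open>The factor \<open>t\<close> is bounded by 1 instead of being integrated. The
        resulting loss of a factor 2 is harmless, because only the order of the remainder matters
        for differentiability.\<close>
      also have "\<dots> \<le> ennreal (2 / \<sigma>\<^sup>2 * (norm h)\<^sup>2)"
        using that mult_right_mono[of t 1 "2 * (norm h)\<^sup>2 / \<sigma>\<^sup>2"]
        by (simp add: power2_eq_square mult_ac flip: ennreal_mult')
      finally show ?thesis .
    qed
  qed
  then show ?thesis by (simp add: algebra_simps)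
qed

section \<open>Integrability, duality and a differentiability criterion\<close>

lemma integrable_lborel_translate:
  fixes f :: "'a::euclidean_space \<Rightarrow> 'b::{banach, second_countable_topology}"
  assumes "integrable lborel f"
  shows "integrable lborel (\<lambda>x. f (a + x))"
proof -
  have "f \<in> borel_measurable borel"
    using borel_measurable_integrable[OF assms] by simp
  then have "f \<in> borel_measurable lborel" "(\<lambda>x. f (a + x)) \<in> borel_measurable lborel"
    "(\<integral>\<^sup>+x. ennreal (norm (f (a + x))) \<partial>lborel) = (\<integral>\<^sup>+x. ennreal (norm (f x)) \<partial>lborel)"
    using nn_integral_lborel_translate[of "\<lambda>x. ennreal (norm (f x))" a] by measurable
  with assms show ?thesis by (simp add: integrable_iff_bounded)
qed

lemma integral_lborel_translate:
  fixes f :: "'a::euclidean_space \<Rightarrow> 'b::{banach, second_countable_topology}"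
  assumes "f \<in> borel_measurable borel"
  shows "(\<integral>x. f (a + x) \<partial>lborel) = (\<integral>x. f x \<partial>lborel)"
  using integral_distr[of "(+) a" lborel borel f] assms by (simp add: lborel_distr_plus)

text \<open>First moments are dominated by the mass and the second moment through
  \<open>\<bar>x\<bar> \<le> 1 + x\<^sup>2\<close>.\<close>

lemma integrable_gaussian_slope:
  assumes "\<sigma> > 0"
  shows "integrable lborel (gaussian_slope \<sigma> v)"
proof (rule Bochner_Integration.integrable_bound)
  show "integrable lborel (\<lambda>z. gaussian_density \<sigma> z + gaussian_density \<sigma> z * (v \<bullet> z)\<^sup>2)"
    by (intro Bochner_Integration.integrable_add integrable_gaussian_density
        integrable_gaussian_inner_square assms)
  have "\<bar>x\<bar> \<le> 1 + x\<^sup>2" for x :: real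
    using zero_le_power2[of "\<bar>x\<bar> - 1"] by (simp add: power2_diff)
  then have "\<bar>v \<bullet> z\<bar> * gaussian_density \<sigma> z \<le> (1 + (v \<bullet> z)\<^sup>2) * gaussian_density \<sigma> z" for z
    by (intro mult_right_mono gaussian_density_nonneg)
  then show "AE z in lborel. norm (gaussian_slope \<sigma> v z)
      \<le> norm (gaussian_density \<sigma> z + gaussian_density \<sigma> z * (v \<bullet> z)\<^sup>2)"
    by (intro always_eventually allI)
      (simp add: gaussian_slope_def abs_mult gaussian_density_nonneg algebra_simps)
qed simp

text \<open>Duality of L^1 and L^infinity: it transfers the L^1 estimates for kernels to integrals
  against \<open>F\<close>.\<close>

lemma abs_integral_mult_le:
  fixes F d :: "'a \<Rightarrow> real"
  assumes "\<And>x. \<bar>F x\<bar> \<le> 1" and "(\<integral>\<^sup>+x. ennreal \<bar>d x\<bar> \<partial>M) \<le> ennreal K" and "0 \<le> K"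
  shows "\<bar>\<integral>x. F x * d x \<partial>M\<bar> \<le> K"
proof (cases "integrable M (\<lambda>x. F x * d x)")
  case True
  have "ennreal \<bar>\<integral>x. F x * d x \<partial>M\<bar> \<le> (\<integral>\<^sup>+x. ennreal \<bar>F x * d x\<bar> \<partial>M)"
    using integral_norm_bound_ennreal[OF True] by simp
  also have "\<dots> \<le> (\<integral>\<^sup>+x. ennreal \<bar>d x\<bar> \<partial>M)"
    using assms(1) by (intro nn_integral_mono ennreal_leI) (simp add: abs_mult mult_left_le_one_le)
  also note assms(2)
  finally show ?thesis using assms(3) by simp
\<comment> \<open>A non-integrable product has Bochner integral 0 by convention, and
  \<open>0 \<le> K\<close> settles that case.\<close>
qed (simp add: not_integrable_integral_eq assms(3))

lemma has_derivative_of_quadratic_remainder: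
  fixes g :: "'a::real_normed_vector \<Rightarrow> 'b::real_normed_vector"
  assumes "bounded_linear L" and rem: "\<And>h. norm (g (x + h) - g x - L h) \<le> C * (norm h)\<^sup>2"
  shows "(g has_derivative L) (at x)"
  unfolding has_derivative_at
proof
  have "norm (g (x + h) - g x - L h) / norm h \<le> C * norm h" if "h \<noteq> 0" for h
    using rem[of h] that by (simp add: divide_le_eq power2_eq_square mult.assoc)
  then have "\<forall>\<^sub>F h in at 0. norm (norm (g (x + h) - g x - L h) / norm h) \<le> C * norm h"
    by (intro eventually_at_filter[THEN iffD2] always_eventually) simp
  moreover have "((\<lambda>h::'a. C * norm h) \<longlongrightarrow> 0) (at 0)"
    by (auto intro!: tendsto_eq_intros)
  ultimately show "(\<lambda>h. norm (g (x + h) - g x - L h) / norm h) \<midarrow>0\<rightarrow> 0"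
    by (rule Lim_null_comparison)
qed (fact assms(1))

section \<open>Gaussian smoothing of a bounded scalar function\<close>

text \<open>The substitution \<open>y = x + z\<close> has been made, so \<open>x\<close> enters only
  through the smooth kernel and no regularity of \<open>F\<close> is at stake.\<close>

definition gaussian_smoothing :: "real \<Rightarrow> (real ^ 'd \<Rightarrow> real) \<Rightarrow> real ^ 'd \<Rightarrow> real" where
  "gaussian_smoothing \<sigma> F x = (\<integral>y. F y * gaussian_density \<sigma> (y - x) \<partial>lborel)"

text \<open>The candidate derivative at \<open>x\<close> in direction \<open>v\<close>. The minus
  sign of the Gaussian derivative cancels against the one from \<open>y - x\<close>.\<close>

definition gaussian_smoothing_deriv ::
  "real \<Rightarrow> (real ^ 'd \<Rightarrow> real) \<Rightarrow> real ^ 'd \<Rightarrow> real ^ 'd \<Rightarrow> real" where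
  "gaussian_smoothing_deriv \<sigma> F x v = (\<integral>y. F y * gaussian_slope \<sigma> v (y - x) \<partial>lborel) / \<sigma>\<^sup>2"

context
  fixes \<sigma> :: real and F :: "real ^ 'd \<Rightarrow> real"
  assumes \<sigma>: "\<sigma> > 0" and F [measurable]: "F \<in> borel_measurable borel" and F_bound: "\<And>x. \<bar>F x\<bar> \<le> 1"
begin

lemma integrable_bounded_mult_translate:
  fixes d :: "real ^ 'd \<Rightarrow> real"
  assumes "integrable lborel d"
  shows "integrable lborel (\<lambda>y. F y * d (y - x))"
proof (rule Bochner_Integration.integrable_bound)
  show *: "integrable lborel (\<lambda>y. d (y - x))"
    using integrable_lborel_translate[OF assms, of "- x"] by simp
  show "(\<lambda>y. F y * d (y - x)) \<in> borel_measurable lborel"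
    using borel_measurable_integrable[OF *] by measurable
  show "AE y in lborel. norm (F y * d (y - x)) \<le> norm (d (y - x))"
    using F_bound by (simp add: abs_mult mult_left_le_one_le)
qed

lemmas integrable_smoothing_density =
  integrable_bounded_mult_translate[OF integrable_gaussian_density[OF \<sigma>]]
lemmas integrable_smoothing_slope =
  integrable_bounded_mult_translate[OF integrable_gaussian_slope[OF \<sigma>]]

text \<open>Linearity in the direction allows \<open>adjoint\<close> to produce the vector that
  represents this functional, which is the gradient.\<close>

lemma linear_gaussian_smoothing_deriv: "linear (gaussian_smoothing_deriv \<sigma> F x)"
proof
  fix u v :: "real ^ 'd" and c :: real
  show "gaussian_smoothing_deriv \<sigma> F x (u + v)
      = gaussian_smoothing_deriv \<sigma> F x u + gaussian_smoothing_deriv \<sigma> F x v"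
    using integrable_smoothing_slope[of u x] integrable_smoothing_slope[of v x]
    by (simp add: gaussian_smoothing_deriv_def gaussian_slope_def inner_add_left distrib_left distrib_right
        add_divide_distrib)
  show "gaussian_smoothing_deriv \<sigma> F x (c *\<^sub>R u) = c *\<^sub>R gaussian_smoothing_deriv \<sigma> F x u"
    by (simp add: gaussian_smoothing_deriv_def gaussian_slope_scaleR mult.left_commute)
qed

lemma gaussian_smoothing_remainder_le:
  "\<bar>gaussian_smoothing \<sigma> F (x + h) - gaussian_smoothing \<sigma> F x - gaussian_smoothing_deriv \<sigma> F x h\<bar>
    \<le> 2 / \<sigma>\<^sup>2 * (norm h)\<^sup>2"
proof -
  \<comment> \<open>Moving \<open>x\<close> by \<open>h\<close> displaces the kernel by
    \<open>- h\<close>, so the Taylor remainder is taken in direction \<open>- h\<close>.\<close>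
  let ?r = "\<lambda>z. gaussian_density \<sigma> (z + (- h)) - gaussian_density \<sigma> z + gaussian_slope \<sigma> (- h) z / \<sigma>\<^sup>2"
  have "(\<integral>\<^sup>+z. ennreal \<bar>?r (- x + z)\<bar> \<partial>lborel) = (\<integral>\<^sup>+z. ennreal \<bar>?r z\<bar> \<partial>lborel)"
    by (rule nn_integral_lborel_translate[where f = "\<lambda>z. ennreal \<bar>?r z\<bar>"]) measurable
  also have "\<dots> \<le> ennreal (2 / \<sigma>\<^sup>2 * (norm (- h))\<^sup>2)"
    by (rule nn_integral_gaussian_density_remainder_le[OF \<sigma>])
  finally have "\<bar>\<integral>y. F y * ?r (- x + y) \<partial>lborel\<bar> \<le> 2 / \<sigma>\<^sup>2 * (norm h)\<^sup>2"
    by (intro abs_integral_mult_le F_bound) simp_all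
  moreover have "(\<integral>y. F y * ?r (- x + y) \<partial>lborel)
    = (\<integral>y. F y * gaussian_density \<sigma> (y - (x + h)) - F y * gaussian_density \<sigma> (y - x)
        - F y * gaussian_slope \<sigma> h (y - x) / \<sigma>\<^sup>2 \<partial>lborel)"
    by (intro Bochner_Integration.integral_cong refl)
      (simp add: gaussian_slope_minus diff_diff_eq right_diff_distrib distrib_left)
  moreover have "\<dots> = gaussian_smoothing \<sigma> F (x + h) - gaussian_smoothing \<sigma> F x - gaussian_smoothing_deriv \<sigma> F x h"
    using integrable_smoothing_density integrable_smoothing_slope
    by (simp add: gaussian_smoothing_def gaussian_smoothing_deriv_def)
  ultimately show ?thesis by simp
qed

text \<open>Since \<open>y - x\<^sub>1 = (y - x\<^sub>2) + (x\<^sub>2 - x\<^sub>1)\<close>, the two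
  kernels differ by an increment of the slope, whose L^1 norm is already bounded.\<close>

lemma gaussian_smoothing_deriv_lipschitz:
  "\<bar>gaussian_smoothing_deriv \<sigma> F x\<^sub>1 v - gaussian_smoothing_deriv \<sigma> F x\<^sub>2 v\<bar>
    \<le> 2 / \<sigma>\<^sup>2 * norm v * norm (x\<^sub>1 - x\<^sub>2)"
proof -
  let ?r = "\<lambda>z. gaussian_slope \<sigma> v (z + (x\<^sub>2 - x\<^sub>1)) - gaussian_slope \<sigma> v z"
  have "(\<integral>\<^sup>+z. ennreal \<bar>?r (- x\<^sub>2 + z)\<bar> \<partial>lborel) = (\<integral>\<^sup>+z. ennreal \<bar>?r z\<bar> \<partial>lborel)"
    by (rule nn_integral_lborel_translate[where f = "\<lambda>z. ennreal \<bar>?r z\<bar>"]) measurable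
  also have "\<dots> \<le> ennreal (2 * norm v * norm (x\<^sub>2 - x\<^sub>1))"
    by (rule nn_integral_gaussian_slope_increment_le[OF \<sigma>])
  finally have "\<bar>\<integral>y. F y * ?r (- x\<^sub>2 + y) \<partial>lborel\<bar> \<le> 2 * norm v * norm (x\<^sub>2 - x\<^sub>1)"
    by (intro abs_integral_mult_le F_bound) simp_all
  moreover have "(\<integral>y. F y * ?r (- x\<^sub>2 + y) \<partial>lborel)
    = (\<integral>y. F y * gaussian_slope \<sigma> v (y - x\<^sub>1) - F y * gaussian_slope \<sigma> v (y - x\<^sub>2) \<partial>lborel)"
    by (intro Bochner_Integration.integral_cong refl) (simp add: right_diff_distrib)
  moreover have "\<dots> = \<sigma>\<^sup>2 * (gaussian_smoothing_deriv \<sigma> F x\<^sub>1 v - gaussian_smoothing_deriv \<sigma> F x\<^sub>2 v)"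
    using \<sigma> integrable_smoothing_slope
    by (simp add: gaussian_smoothing_deriv_def right_diff_distrib)
  ultimately have "\<sigma>\<^sup>2 * \<bar>gaussian_smoothing_deriv \<sigma> F x\<^sub>1 v - gaussian_smoothing_deriv \<sigma> F x\<^sub>2 v\<bar>
      \<le> 2 * norm v * norm (x\<^sub>2 - x\<^sub>1)"
    by (simp only: abs_mult abs_power2)
  then show ?thesis
    using \<sigma> unfolding norm_minus_commute[of x\<^sub>2 x\<^sub>1] by (simp add: pos_le_divide_eq mult_ac)
qed

text \<open>For a linear functional \<open>L\<close>, the vector \<open>adjoint L 1\<close>
  satisfies \<open>h \<bullet> adjoint L 1 = L h\<close>. The quadratic remainder bound therefore
  identifies it as the gradient.\<close>

lemma gderiv_gaussian_smoothing:
  "GDERIV (gaussian_smoothing \<sigma> F) x :> adjoint (gaussian_smoothing_deriv \<sigma> F x) 1"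
  unfolding gderiv_def
proof (rule has_derivative_of_quadratic_remainder)
  show "bounded_linear (\<lambda>h. h \<bullet> adjoint (gaussian_smoothing_deriv \<sigma> F x) 1)"
    by (rule bounded_linear_inner_left)
  show "norm (gaussian_smoothing \<sigma> F (x + h) - gaussian_smoothing \<sigma> F x
      - h \<bullet> adjoint (gaussian_smoothing_deriv \<sigma> F x) 1) \<le> 2 / \<sigma>\<^sup>2 * (norm h)\<^sup>2" for h
    using gaussian_smoothing_remainder_le[of x h]
    by (simp add: adjoint_works[OF linear_gaussian_smoothing_deriv])
qed

text \<open>The directional estimate is tested on the gradient difference \<open>D\<close> itself.
  Its left side becomes the square of \<open>norm D\<close>, and one factor cancels.\<close>

lemma gradient_gaussian_smoothing_lipschitz:
  "norm (gradient (gaussian_smoothing \<sigma> F) x\<^sub>1 - gradient (gaussian_smoothing \<sigma> F) x\<^sub>2)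
    \<le> 2 / \<sigma>\<^sup>2 * norm (x\<^sub>1 - x\<^sub>2)"
proof -
  define D where "D = gradient (gaussian_smoothing \<sigma> F) x\<^sub>1 - gradient (gaussian_smoothing \<sigma> F) x\<^sub>2"
  have "norm D * norm D = D \<bullet> D"
    by (simp add: norm_eq_sqrt_inner)
  also have "\<dots> = D \<bullet> gradient (gaussian_smoothing \<sigma> F) x\<^sub>1 - D \<bullet> gradient (gaussian_smoothing \<sigma> F) x\<^sub>2"
    by (subst (2) D_def) (rule inner_diff_right)
  also have "\<dots> = gaussian_smoothing_deriv \<sigma> F x\<^sub>1 D - gaussian_smoothing_deriv \<sigma> F x\<^sub>2 D"
    by (simp add: gradient_eqI[OF gderiv_gaussian_smoothing]
        adjoint_works[OF linear_gaussian_smoothing_deriv])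
  also have "\<dots> \<le> (2 / \<sigma>\<^sup>2 * norm (x\<^sub>1 - x\<^sub>2)) * norm D"
    using gaussian_smoothing_deriv_lipschitz[of x\<^sub>1 D x\<^sub>2] by (simp add: mult_ac)
  finally have "norm D * norm D \<le> (2 / \<sigma>\<^sup>2 * norm (x\<^sub>1 - x\<^sub>2)) * norm D" .
  then have "norm D \<le> 2 / \<sigma>\<^sup>2 * norm (x\<^sub>1 - x\<^sub>2)" if "D \<noteq> 0"
    by (rule mult_right_le_imp_le) (simp add: that)
  then have "norm D \<le> 2 / \<sigma>\<^sup>2 * norm (x\<^sub>1 - x\<^sub>2)"
    by (cases "D = 0") simp_all
  then show ?thesis
    unfolding D_def .
qed

end

section \<open>The smoothed confidence function and its coordinates\<close>

text \<open>This links the expectation over \<open>M\<close> to the kernel form: take a coordinate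
  inside the integral, pass to the density of \<open>\<epsilon>\<close>, then translate by
  \<open>x\<close>.\<close>

lemma soft_smoothed_nth:
  fixes \<epsilon> :: "'a \<Rightarrow> real ^ 'd" and f :: "real ^ 'd \<Rightarrow> real ^ 'c"
  assumes "gaussian_rv M \<sigma> \<epsilon>" and [measurable]: "f \<in> borel_measurable borel"
    and bound: "\<And>x. norm (f x) \<le> B"
  shows "soft_smoothed M \<epsilon> f x $ j = gaussian_smoothing \<sigma> (\<lambda>y. f y $ j) x"
proof -
  interpret prob_space M using assms(1) by (simp add: gaussian_rv_def)
  have dist: "distributed M lborel \<epsilon> (\<lambda>x. ennreal (gaussian_density \<sigma> x))"
    using assms(1) by (simp add: gaussian_rv_def)
  then have [measurable]: "\<epsilon> \<in> borel_measurable M"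
    using distributed_measurable by fastforce
  have nth [measurable]: "(\<lambda>y. f y $ j) \<in> borel_measurable borel"
    by (rule measurable_compose[OF assms(2)])
      (intro borel_measurable_continuous_onI continuous_intros)
  \<comment> \<open>Boundedness on a probability space gives integrability of the vector-valued
    function, so the coordinate projection commutes with the integral.\<close>
  have "integrable M (\<lambda>\<omega>. f (x + \<epsilon> \<omega>))"
    by (rule integrable_const_bound[where B = B]) (auto simp: bound)
  then have "soft_smoothed M \<epsilon> f x $ j = (\<integral>\<omega>. f (x + \<epsilon> \<omega>) $ j \<partial>M)"
    unfolding soft_smoothed_def
    by (rule integral_bounded_linear[OF bounded_linear_vec_nth, symmetric])
  also have "\<dots> = (\<integral>z. gaussian_density \<sigma> z * f (x + z) $ j \<partial>lborel)"
    by (intro distributed_integral[OF dist, symmetric]) (auto simp: gaussian_density_nonneg)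
  also have "\<dots> = gaussian_smoothing \<sigma> (\<lambda>y. f y $ j) x"
    using integral_lborel_translate[of "\<lambda>y. f y $ j * gaussian_density \<sigma> (y - x)" x]
    by (simp add: gaussian_smoothing_def mult.commute)
  finally show ?thesis .
qed

lemma prob_simplex_sum_abs: "p \<in> prob_simplex \<Longrightarrow> (\<Sum>i\<in>UNIV. \<bar>p $ i\<bar>) = 1"
  by (simp only: prob_simplex_def mem_Collect_eq)

lemma prob_simplex_nth_abs_le:
  assumes "p \<in> prob_simplex"
  shows "\<bar>p $ i\<bar> \<le> 1"
  using member_le_sum[of i UNIV "\<lambda>i. \<bar>p $ i\<bar>"] by (simp add: prob_simplex_sum_abs[OF assms])

theorem theorem2:
  fixes M :: "'a measure"
    and \<epsilon> :: "'a \<Rightarrow> real ^ 'd"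
    and f :: "real ^ 'd \<Rightarrow> real ^ 'c"
    and \<sigma> :: real
  assumes "\<sigma> > 0"
    and "gaussian_rv M \<sigma> \<epsilon>"
    and "f \<in> borel_measurable borel"
    and "\<And>x. f x \<in> prob_simplex"
  shows "smooth_with (2 / \<sigma>\<^sup>2) (soft_smoothed M \<epsilon> f)"
proof -
  let ?g = "\<lambda>j. gaussian_smoothing \<sigma> (\<lambda>y. f y $ j)"
  have bound: "\<bar>f x $ j\<bar> \<le> 1" for x j
    using assms(4) by (rule prob_simplex_nth_abs_le)
  have meas: "(\<lambda>y. f y $ j) \<in> borel_measurable borel" for j
    by (rule measurable_compose[OF assms(3)])
      (intro borel_measurable_continuous_onI continuous_intros)
  \<comment> \<open>The Euclidean norm is at most the l1 norm, which is 1 on the simplex.\<close>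
  have "norm (f x) \<le> 1" for x
    using norm_le_l1_cart[of "f x"] by (simp add: prob_simplex_sum_abs[OF assms(4)])
  note nth = soft_smoothed_nth[OF assms(2,3) this]
  have "soft_smoothed M \<epsilon> f differentiable (at x)" for x
  proof (rule differentiable_componentwise_within[THEN iffD2], intro ballI)
    fix b :: "real ^ 'c" assume "b \<in> Basis"
    then obtain j where b: "b = axis j 1"
      by (auto simp: Basis_vec_def)
    have "?g j differentiable (at x)"
      using gderiv_gaussian_smoothing[OF assms(1) meas bound, where x = x]
      unfolding gderiv_def differentiable_def by blast
    then show "(\<lambda>x. soft_smoothed M \<epsilon> f x \<bullet> b) differentiable (at x)"
      by (simp add: b inner_axis nth)
  qed
  moreover have "norm (gradient (\<lambda>x. soft_smoothed M \<epsilon> f x $ j) x\<^sub>1 - gradient (\<lambda>x. soft_smoothed M \<epsilon> f x $ j) x\<^sub>2)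
      \<le> 2 / \<sigma>\<^sup>2 * norm (x\<^sub>1 - x\<^sub>2)" for j x\<^sub>1 x\<^sub>2
    unfolding nth by (rule gradient_gaussian_smoothing_lipschitz[OF assms(1) meas bound])
  ultimately show ?thesis
    by (simp add: smooth_with_def)
qed

end
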